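(* Let $b_1,b_2>0$, let $A$ be the operator on $l^2(\mathbb{Z}^* )$ defined in the context, and let $\lambda\in\mathbb{C}\setminus[-4\max\{b_1^{-2},b_2^{-2}\},0]$. For any $g\in l^2(\mathbb{Z}^* )$ there exists a unique solution $f\in l^2(\mathbb{Z}^* )$ of the equation $(A-\lambda I)f=g$. Moreover, it is given by the following formula: for $s\in\{1,2\}$ and $j\in Z_s$, $$f(j)=\frac{-r_s^{|j|}}{b_2^{-2}(1-r_2)+b_1^{-2}(1-r_1)}\Big[\sum_{k\in Z_1}r_1^{|k|}g(k)+\sum_{k\in Z_2}r_2^{|k|}g(k)\Big]+\frac{b_s^2}{r_s-r_s^{-1}}\sum_{k\in Z_s}\big(r_s^{|j-k|}-r_s^{|j|+|k|}\big)g(k),$$ where for $s\in\{1,2\}$, $r_s=r_s(\lambda)$ is the unique solution with $|r_s|<1$ of the equation $$r_s^2-2r_s+1=\lambda b_s^2r_s.$$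
   Context: $\mathbb{Z}^*=\mathbb{Z}\setminus\{0\}$, $Z_1=\mathbb{Z}\cap(-\infty,-1]$, $Z_2=\mathbb{Z}\cap[1,\infty)$. The operator $A$ acts on $f=(f(j))_{j\in\mathbb{Z}^*}\in l^2(\mathbb{Z}^* )$ by $(Af)(j)=b_1^{-2}(f(j+1)-2f(j)+f(j-1))$ for $j\le-2$; $(Af)(-1)=b_1^{-2}f(-2)-\big(b_1^{-2}+\frac1{b_1^2+b_2^2}\big)f(-1)+\frac1{b_1^2+b_2^2}f(1)$; $(Af)(1)=\frac1{b_1^2+b_2^2}f(-1)-\big(\frac1{b_1^2+b_2^2}+b_2^{-2}\big)f(1)+b_2^{-2}f(2)$; $(Af)(j)=b_2^{-2}(f(j+1)-2f(j)+f(j-1))$ for $j\ge2$. *)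

theory Defs
  imports "HOL-Analysis.Analysis"
begin

definition Zstar :: "int set" where
  "Zstar = UNIV - {0}"

definition Zhalf :: "nat \<Rightarrow> int set" where
  "Zhalf s = (if s = 1 then {..-1} else {1..})"

text \<open>A function on \<open>S\<close> is represented by its extension by zero to all of \<open>int\<close>, so that
  equality of functions on \<open>S\<close> is plain equality.\<close>

definition l2 :: "int set \<Rightarrow> (int \<Rightarrow> complex) set" where
  "l2 S = {f. (\<forall>j. j \<notin> S \<longrightarrow> f j = 0) \<and> (\<lambda>j. (cmod (f j))\<^sup>2) summable_on S}"

text \<open>Only \<open>b 1\<close> and \<open>b 2\<close> are relevant. The value at the excluded index \<open>0\<close> is the zero
  prescribed by the convention above.\<close>

definition opA :: "(nat \<Rightarrow> real) \<Rightarrow> (int \<Rightarrow> complex) \<Rightarrow> int \<Rightarrow> complex" where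
  "opA b f j =
    (let c1 = complex_of_real (1 / (b 1)\<^sup>2);
         c2 = complex_of_real (1 / (b 2)\<^sup>2);
         d = complex_of_real (1 / ((b 1)\<^sup>2 + (b 2)\<^sup>2))
     in if j \<le> -2 then c1 * (f (j + 1) - 2 * f j + f (j - 1))
        else if j = -1 then c1 * f (-2) - (c1 + d) * f (-1) + d * f 1
        else if j = 1 then d * f (-1) - (d + c2) * f 1 + c2 * f 2
        else if j \<ge> 2 then c2 * (f (j + 1) - 2 * f j + f (j - 1))
        else 0)"

definition is_small_root :: "real \<Rightarrow> complex \<Rightarrow> complex \<Rightarrow> bool" where
  "is_small_root \<beta> lam z \<longleftrightarrow>
     cmod z < 1 \<and> z\<^sup>2 - 2 * z + 1 = lam * complex_of_real (\<beta>\<^sup>2) * z"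

definition small_root :: "real \<Rightarrow> complex \<Rightarrow> complex" where
  "small_root \<beta> lam = (THE z. is_small_root \<beta> lam z)"

end

theory Submission
  imports Defs
begin

text \<open>
  The operator is a discrete Laplacian on two half-lines, joined by a single bond from \<open>-1\<close> to \<open>1\<close>. That
  bond can be cut by an artificial node at \<open>0\<close>: if \<open>f\<close> is given there the weighted mean of \<open>f (-1)\<close> and
  \<open>f 1\<close> called \<open>interface_value\<close>, the operator acts on each half as \<open>1 / (b s)\<^sup>2\<close> times the plain second
  difference, all the way up to the node (\<open>opA_eq_second_difference\<close>). Since
  \<open>lam = (r s + inverse (r s) - 2) / (b s)\<^sup>2\<close>, the equation becomes, on either half,
  \<open>F (j + 1) + F (j - 1) - (r s + inverse (r s)) F j = (b s)\<^sup>2 g j\<close>.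

  On one half-line this is solved by hand. The kernel \<open>r\<^bsup>\<bar>j - k\<bar>\<^esup> - r\<^bsup>\<bar>j\<bar> + \<bar>k\<bar>\<^esup>\<close> gives the solution that
  vanishes at \<open>0\<close>; as it is dominated by \<open>2 \<bar>r\<bar>\<^bsup>\<bar>j - k\<bar>\<^esup>\<close>, the Schur test shows that it preserves square
  summability. The homogeneous solutions are spanned by \<open>r\<^bsup>\<bar>j\<bar>\<^esup>\<close> and the growing \<open>r\<^bsup>- \<bar>j\<bar>\<^esup>\<close>, so a
  square-summable solution is determined by its value \<open>u\<close> at \<open>0\<close> (\<open>half_line_unique\<close>).

  What remains is one scalar equation: the two half-line solutions must share the value \<open>u\<close>, and
  \<open>u\<close> must be the interface value of the result. This reads \<open>D u = -\<close> (sum of the boundary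
  functionals of \<open>g\<close>), by \<open>balance_iff\<close>. It has exactly one solution because \<open>\<bar>r s\<bar> < 1\<close> makes the
  real part of \<open>D\<close> positive. Existence, uniqueness and the formula are thus one equivalence,
  \<open>resolvent_solution_iff\<close>.
\<close>

section \<open>The root inside the unit disc\<close>

text \<open>The quadratic is palindromic, so its two roots have product one: exactly one of them lies
  inside the unit circle unless both lie on it. A root \<open>z\<close> on the circle has \<open>inverse z = cnj z\<close>, whence
  \<open>lam \<beta>\<^sup>2 = 2 Re z - 2\<close>, which puts \<open>lam\<close> in the excluded interval.\<close>

lemma ex1_small_root:
  assumes "\<beta> > 0" and "lam \<notin> complex_of_real ` {- 4 / \<beta>\<^sup>2 .. 0}"
  shows "\<exists>!z. is_small_root \<beta> lam z"
proof -
  define t where "t = 2 + lam * complex_of_real (\<beta>\<^sup>2)"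
  have root_iff: "z\<^sup>2 - 2 * z + 1 = lam * complex_of_real (\<beta>\<^sup>2) * z \<longleftrightarrow> z\<^sup>2 - t * z + 1 = 0" for z
    by (auto simp: t_def algebra_simps)
  have off_circle: "cmod z \<noteq> 1" if z: "z\<^sup>2 - t * z + 1 = 0" for z
  proof
    assume unit: "cmod z = 1"
    then have zc: "z * cnj z = 1"
      by (simp add: complex_norm_square[symmetric])
    have "z * t = z * (z + cnj z)"
      using z zc by (simp add: power2_eq_square algebra_simps)
    then have "t = z + cnj z" using unit by auto
    then have "lam * complex_of_real (\<beta>\<^sup>2) = complex_of_real (2 * Re z - 2)"
      by (simp add: t_def complex_add_cnj algebra_simps)
    then have "lam = complex_of_real ((2 * Re z - 2) / \<beta>\<^sup>2)"
      using assms(1) by (simp add: field_simps)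
    moreover have "\<bar>Re z\<bar> \<le> 1" using abs_Re_le_cmod[of z] unit by simp
    then have "(2 * Re z - 2) / \<beta>\<^sup>2 \<in> {- 4 / \<beta>\<^sup>2 .. 0}"
      using assms(1) by (simp add: divide_simps abs_le_iff)
    ultimately show False using assms(2) by blast
  qed
  define d where "d = csqrt (t\<^sup>2 - 4)"
  have d2: "d\<^sup>2 = t\<^sup>2 - 4" by (simp add: d_def)
  define z1 z2 where "z1 = (t + d) / 2" and "z2 = (t - d) / 2"
  have sum: "z1 + z2 = t" by (simp add: z1_def z2_def field_simps)
  have "4 * (z1 * z2) = (t + d) * (t - d)" by (simp add: z1_def z2_def)
  also have "\<dots> = t\<^sup>2 - d\<^sup>2" by (simp add: power2_eq_square algebra_simps)
  finally have "4 * (z1 * z2) = t\<^sup>2 - d\<^sup>2" .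
  then have prod: "z1 * z2 = 1" using d2 by simp
  have roots: "z1\<^sup>2 - t * z1 + 1 = 0" "z2\<^sup>2 - t * z2 + 1 = 0"
    unfolding sum[symmetric] prod[symmetric] by (simp_all add: power2_eq_square algebra_simps)
  have "cmod z1 * cmod z2 = 1" using prod by (metis norm_mult norm_one)
  then have "cmod z1 < 1 \<or> cmod z2 < 1"
    using off_circle[OF roots(1)] off_circle[OF roots(2)]
    by (smt (verit) mult_le_cancel_left1 norm_ge_zero)
  then have ex: "\<exists>z. is_small_root \<beta> lam z"
    using roots root_iff unfolding is_small_root_def by blast
  have "w = z" if "is_small_root \<beta> lam w" "is_small_root \<beta> lam z" for w z
  proof (rule ccontr)
    assume "w \<noteq> z"
    have w: "w\<^sup>2 - t * w + 1 = 0" and z: "z\<^sup>2 - t * z + 1 = 0"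
      using that root_iff unfolding is_small_root_def by blast+
    have "(w - z) * (w + z - t) = (w\<^sup>2 - t * w + 1) - (z\<^sup>2 - t * z + 1)"
      by (simp add: power2_eq_square algebra_simps)
    then have "(w - z) * (w + z - t) = 0" using w z by simp
    then have "t = w + z" using \<open>w \<noteq> z\<close> by auto
    then have "w * z = 1" using w by (simp add: power2_eq_square algebra_simps)
    then have "cmod w * cmod z = 1" by (metis norm_mult norm_one)
    moreover have "cmod w * cmod z < 1 * 1"
      using that unfolding is_small_root_def by (intro mult_strict_mono') auto
    ultimately show False by simp
  qed
  with ex show ?thesis by blast
qed

lemma is_small_root_small_root:
  assumes "\<exists>!z. is_small_root \<beta> lam z"
  shows "is_small_root \<beta> lam (small_root \<beta> lam)"
  unfolding small_root_def using assms by (rule theI')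

lemma is_small_root_nonzero:
  assumes "is_small_root \<beta> lam z"
  shows "z \<noteq> 0"
  using assms unfolding is_small_root_def by auto

lemma lam_eq_small_root:
  assumes "\<beta> > 0" "is_small_root \<beta> lam z"
  shows "lam = complex_of_real (1 / \<beta>\<^sup>2) * (z + inverse z - 2)"
proof -
  have "z \<noteq> 0" using is_small_root_nonzero[OF assms(2)] .
  then show ?thesis
    using assms unfolding is_small_root_def
    by (simp add: field_simps power2_eq_square)
qed

lemma minus_inverse_nonzero:
  fixes z :: complex
  assumes "z \<noteq> 0" "cmod z < 1"
  shows "z - inverse z \<noteq> 0"
proof
  assume "z - inverse z = 0"
  then have "z * z = 1" using assms(1) by (simp add: field_simps)
  then have "cmod z * cmod z = 1" by (metis norm_mult norm_one)
  moreover have "cmod z * cmod z < 1 * 1" using assms(2) by (intro mult_strict_mono') auto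
  ultimately show False by simp
qed

section \<open>Boundedness of kernel operators on square-summable functions\<close>

lemma infsum_finite_sum:
  fixes f :: "'j \<Rightarrow> 'i \<Rightarrow> real"
  assumes "finite F" "\<And>j. j \<in> F \<Longrightarrow> f j summable_on I"
  shows "(\<lambda>k. \<Sum>j\<in>F. f j k) summable_on I"
    and "(\<Sum>\<^sub>\<infinity>k\<in>I. \<Sum>j\<in>F. f j k) = (\<Sum>j\<in>F. infsum (f j) I)"
proof -
  have "(\<lambda>k. \<Sum>j\<in>F. f j k) summable_on I \<and>
      (\<Sum>\<^sub>\<infinity>k\<in>I. \<Sum>j\<in>F. f j k) = (\<Sum>j\<in>F. infsum (f j) I)"
    using assms by (induction F rule: finite_induct) (auto simp: infsum_add summable_on_add)
  then show "(\<lambda>k. \<Sum>j\<in>F. f j k) summable_on I"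
    "(\<Sum>\<^sub>\<infinity>k\<in>I. \<Sum>j\<in>F. f j k) = (\<Sum>j\<in>F. infsum (f j) I)" by auto
qed

lemma schur_row_summable:
  fixes \<kappa> a :: "'i \<Rightarrow> complex"
  assumes row: "\<And>F. finite F \<Longrightarrow> F \<subseteq> I \<Longrightarrow> (\<Sum>k\<in>F. cmod (\<kappa> k)) \<le> C"
    and a: "(\<lambda>k. (cmod (a k))\<^sup>2) summable_on I"
  shows "(\<lambda>k. cmod (\<kappa> k) * (cmod (a k))\<^sup>2) summable_on I"
    and "(\<lambda>k. norm (\<kappa> k * a k)) summable_on I"
proof -
  have bd: "cmod (\<kappa> k) \<le> C" if "k \<in> I" for k using row[of "{k}"] that by auto
  have "(\<lambda>k. C * (cmod (a k))\<^sup>2) summable_on I"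
    by (rule summable_on_cmult_right[OF a])
  then show weighted: "(\<lambda>k. cmod (\<kappa> k) * (cmod (a k))\<^sup>2) summable_on I"
    by (rule summable_on_comparison_test) (auto intro: mult_right_mono bd)
  have "(\<lambda>k. cmod (\<kappa> k)) summable_on I"
    by (rule nonneg_bdd_above_summable_on) (auto intro!: bdd_aboveI2 row)
  then have "(\<lambda>k. cmod (\<kappa> k) + cmod (\<kappa> k) * (cmod (a k))\<^sup>2) summable_on I"
    by (rule summable_on_add[OF _ weighted])
  then show "(\<lambda>k. norm (\<kappa> k * a k)) summable_on I"
  proof (rule summable_on_comparison_test)
    fix k
    have "cmod (a k) \<le> 1 + (cmod (a k))\<^sup>2"
      using zero_le_power2[of "cmod (a k) - 1"] norm_ge_zero[of "a k"]
      unfolding power2_diff power_one mult_1_right by linarith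
    then have "cmod (\<kappa> k) * cmod (a k) \<le> cmod (\<kappa> k) * (1 + (cmod (a k))\<^sup>2)"
      by (rule mult_left_mono) simp
    then show "norm (\<kappa> k * a k) \<le> cmod (\<kappa> k) + cmod (\<kappa> k) * (cmod (a k))\<^sup>2"
      by (simp add: norm_mult algebra_simps)
  qed auto
qed

text \<open>Cauchy--Schwarz with the factor \<open>\<bar>\<kappa> k\<bar>\<close> split evenly between the two vectors.\<close>

lemma schur_row_bound:
  fixes \<kappa> a :: "'i \<Rightarrow> complex"
  assumes row: "\<And>F. finite F \<Longrightarrow> F \<subseteq> I \<Longrightarrow> (\<Sum>k\<in>F. cmod (\<kappa> k)) \<le> C"
    and a: "(\<lambda>k. (cmod (a k))\<^sup>2) summable_on I"
  shows "(cmod (\<Sum>\<^sub>\<infinity>k\<in>I. \<kappa> k * a k))\<^sup>2 \<le> C * (\<Sum>\<^sub>\<infinity>k\<in>I. cmod (\<kappa> k) * (cmod (a k))\<^sup>2)"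
proof -
  note summ = schur_row_summable[OF row a]
  define T where "T = (\<Sum>\<^sub>\<infinity>k\<in>I. cmod (\<kappa> k) * (cmod (a k))\<^sup>2)"
  have "C \<ge> 0" using row[of "{}"] by simp
  have "T \<ge> 0" unfolding T_def by (rule infsum_nonneg) simp
  have fin: "(\<Sum>k\<in>F. norm (\<kappa> k * a k)) \<le> sqrt (C * T)" if F: "finite F" "F \<subseteq> I" for F
  proof (rule real_le_rsqrt)
    have "(\<Sum>k\<in>F. norm (\<kappa> k * a k)) = (\<Sum>k\<in>F. sqrt (cmod (\<kappa> k)) * (sqrt (cmod (\<kappa> k)) * cmod (a k)))"
      by (intro sum.cong) (auto simp: norm_mult mult.assoc[symmetric])
    then have "(\<Sum>k\<in>F. norm (\<kappa> k * a k))\<^sup>2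
        \<le> (\<Sum>k\<in>F. (sqrt (cmod (\<kappa> k)))\<^sup>2) * (\<Sum>k\<in>F. (sqrt (cmod (\<kappa> k)) * cmod (a k))\<^sup>2)"
      by (simp only: Cauchy_Schwarz_ineq_sum)
    also have "\<dots> = (\<Sum>k\<in>F. cmod (\<kappa> k)) * (\<Sum>k\<in>F. cmod (\<kappa> k) * (cmod (a k))\<^sup>2)"
      by (simp add: power_mult_distrib)
    also have "\<dots> \<le> C * T"
      unfolding T_def using F \<open>C \<ge> 0\<close>
      by (intro mult_mono row finite_sum_le_infsum summ(1) sum_nonneg) auto
    finally show "(\<Sum>k\<in>F. norm (\<kappa> k * a k))\<^sup>2 \<le> C * T" .
  qed
  have "cmod (\<Sum>\<^sub>\<infinity>k\<in>I. \<kappa> k * a k) \<le> (\<Sum>\<^sub>\<infinity>k\<in>I. norm (\<kappa> k * a k))"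
    by (rule norm_infsum_bound[OF summ(2)])
  also have "\<dots> \<le> sqrt (C * T)"
    by (rule infsum_le_finite_sums[OF summ(2) fin])
  finally have "(cmod (\<Sum>\<^sub>\<infinity>k\<in>I. \<kappa> k * a k))\<^sup>2 \<le> (sqrt (C * T))\<^sup>2"
    by (rule power_mono) simp
  then show ?thesis using \<open>C \<ge> 0\<close> \<open>T \<ge> 0\<close> by (simp add: T_def)
qed

text \<open>This is the Schur test. Summing the row bound of \<open>schur_row_bound\<close> over finitely many
  rows and exchanging a finite with an infinite sum brings in the column sums, so that
  the \<open>l\<^sup>2\<close> norm of the image is at most \<open>C\<close> times that of \<open>a\<close>. The hypotheses speak of
  finite partial sums because these are all that the argument ever evaluates.\<close>

lemma schur_test:
  fixes K :: "'j \<Rightarrow> 'i \<Rightarrow> complex" and a :: "'i \<Rightarrow> complex"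
  assumes row: "\<And>j F. j \<in> J \<Longrightarrow> finite F \<Longrightarrow> F \<subseteq> I \<Longrightarrow> (\<Sum>k\<in>F. cmod (K j k)) \<le> C"
    and col: "\<And>k F. k \<in> I \<Longrightarrow> finite F \<Longrightarrow> F \<subseteq> J \<Longrightarrow> (\<Sum>j\<in>F. cmod (K j k)) \<le> C"
    and a: "(\<lambda>k. (cmod (a k))\<^sup>2) summable_on I"
  shows "(\<lambda>j. (cmod (\<Sum>\<^sub>\<infinity>k\<in>I. K j k * a k))\<^sup>2) summable_on J"
proof (cases "J = {}")
  case False
  then have "C \<ge> 0" using row[of _ "{}"] by auto
  have "(\<Sum>j\<in>F. (cmod (\<Sum>\<^sub>\<infinity>k\<in>I. K j k * a k))\<^sup>2) \<le> C * (\<Sum>\<^sub>\<infinity>k\<in>I. C * (cmod (a k))\<^sup>2)"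
    if F: "finite F" "F \<subseteq> J" for F
  proof -
    have summ: "(\<lambda>k. cmod (K j k) * (cmod (a k))\<^sup>2) summable_on I" if "j \<in> F" for j
      using schur_row_summable(1)[OF row a] that F by blast
    have "(\<Sum>j\<in>F. (cmod (\<Sum>\<^sub>\<infinity>k\<in>I. K j k * a k))\<^sup>2)
        \<le> (\<Sum>j\<in>F. C * (\<Sum>\<^sub>\<infinity>k\<in>I. cmod (K j k) * (cmod (a k))\<^sup>2))"
      using F by (intro sum_mono schur_row_bound row a) auto
    also have "\<dots> = C * (\<Sum>\<^sub>\<infinity>k\<in>I. \<Sum>j\<in>F. cmod (K j k) * (cmod (a k))\<^sup>2)"
      using infsum_finite_sum(2)[OF F(1) summ] by (simp add: sum_distrib_left)
    also have "\<dots> \<le> C * (\<Sum>\<^sub>\<infinity>k\<in>I. C * (cmod (a k))\<^sup>2)"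
    proof (intro mult_left_mono infsum_mono \<open>C \<ge> 0\<close>)
      show "(\<lambda>k. \<Sum>j\<in>F. cmod (K j k) * (cmod (a k))\<^sup>2) summable_on I"
        by (rule infsum_finite_sum(1)[OF F(1) summ])
      show "(\<lambda>k. C * (cmod (a k))\<^sup>2) summable_on I"
        by (rule summable_on_cmult_right[OF a])
      fix k assume "k \<in> I"
      then show "(\<Sum>j\<in>F. cmod (K j k) * (cmod (a k))\<^sup>2) \<le> C * (cmod (a k))\<^sup>2"
        using F col by (simp add: sum_distrib_right[symmetric] mult_right_mono)
    qed
    finally show ?thesis .
  qed
  then show ?thesis
    by (intro nonneg_bdd_above_summable_on) (auto intro!: bdd_aboveI2)
qed auto

section \<open>The Green kernel of a half-line\<close>

lemma summable_on_power_abs: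
  fixes \<rho> :: real
  assumes "0 \<le> \<rho>" "\<rho> < 1"
  shows "(\<lambda>k::int. \<rho> ^ nat \<bar>k\<bar>) summable_on UNIV"
proof -
  have nat: "(\<lambda>n. \<rho> ^ n) summable_on (UNIV :: nat set)"
    using assms by (subst summable_on_UNIV_nonneg_real_iff) (auto intro: summable_geometric)
  have "(\<lambda>k::int. \<rho> ^ nat \<bar>k\<bar>) summable_on range int"
    using nat by (subst summable_on_reindex) (auto simp: o_def)
  moreover have "(\<lambda>k::int. \<rho> ^ nat \<bar>k\<bar>) summable_on range (\<lambda>n. - int n)"
    using nat by (subst summable_on_reindex) (auto simp: o_def inj_on_def)
  ultimately have "(\<lambda>k::int. \<rho> ^ nat \<bar>k\<bar>) summable_on (range int \<union> range (\<lambda>n. - int n))"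
    by (rule summable_on_union)
  moreover have "range int \<union> range (\<lambda>n. - int n) = UNIV"
  proof -
    have "k \<in> range int \<union> range (\<lambda>n. - int n)" for k :: int
      by (cases k rule: int_cases2) auto
    then show ?thesis by blast
  qed
  ultimately show ?thesis by simp
qed

lemma finite_sum_power_dist_le:
  fixes \<rho> :: real
  assumes "0 \<le> \<rho>" "\<rho> < 1" "finite F"
  shows "(\<Sum>k\<in>F. \<rho> ^ nat \<bar>j - k\<bar>) \<le> (\<Sum>\<^sub>\<infinity>k::int. \<rho> ^ nat \<bar>k\<bar>)"
proof -
  have "(\<Sum>k\<in>F. \<rho> ^ nat \<bar>j - k\<bar>) = (\<Sum>k\<in>(\<lambda>k. j - k) ` F. \<rho> ^ nat \<bar>k\<bar>)"
    by (subst sum.reindex) (auto simp: inj_on_def)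
  also have "\<dots> \<le> (\<Sum>\<^sub>\<infinity>k::int. \<rho> ^ nat \<bar>k\<bar>)"
    using assms by (intro finite_sum_le_infsum summable_on_power_abs) auto
  finally show ?thesis .
qed

text \<open>The kernel below is the free kernel \<open>r\<^bsup>\<bar>j - k\<bar>\<^esup>\<close> minus its mirror image in the
  origin, so that it vanishes at \<open>j = 0\<close>: the method of images for a Dirichlet condition.\<close>

definition green_kernel :: "complex \<Rightarrow> int \<Rightarrow> int \<Rightarrow> complex" where
  "green_kernel r j k = r ^ nat \<bar>j - k\<bar> - r ^ (nat \<bar>j\<bar> + nat \<bar>k\<bar>)"

lemma second_difference_power_abs:
  fixes r :: complex and n :: int
  assumes "r \<noteq> 0"
  shows "r ^ nat \<bar>n + 1\<bar> + (r ^ nat \<bar>n - 1\<bar>) - (r + inverse r) * r ^ nat \<bar>n\<bar>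
    = (if n = 0 then r - inverse r else 0)"
proof -
  have step: "r ^ Suc (Suc m) + r ^ m - (r + inverse r) * r ^ Suc m = 0" for m
    using assms by (simp add: field_simps)
  consider "n = 0" | m where "n = int (Suc m)" | m where "n = - int (Suc m)"
    by (metis int_cases not0_implies_Suc of_nat_0)
  then show ?thesis
  proof cases
    case 1
    then show ?thesis by simp
  next
    case 2
    then have "nat \<bar>n + 1\<bar> = Suc (Suc m)" "nat \<bar>n - 1\<bar> = m" "nat \<bar>n\<bar> = Suc m" "n \<noteq> 0" by auto
    then show ?thesis using step[of m] by simp
  next
    case 3
    then have "nat \<bar>n + 1\<bar> = m" "nat \<bar>n - 1\<bar> = Suc (Suc m)" "nat \<bar>n\<bar> = Suc m" "n \<noteq> 0" by auto
    then show ?thesis using step[of m] by (simp add: add.commute)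
  qed
qed

text \<open>The image term \<open>r\<^bsup>\<bar>j\<bar>\<^esup> r\<^bsup>\<bar>k\<bar>\<^esup>\<close> solves the homogeneous equation away from \<open>j = 0\<close>, so
  the only source is that of the free kernel, at \<open>j = k\<close>.\<close>

lemma green_kernel_second_difference:
  assumes "r \<noteq> 0" "j \<noteq> 0"
  shows "green_kernel r (j + 1) k + green_kernel r (j - 1) k - (r + inverse r) * green_kernel r j k
    = (if k = j then r - inverse r else 0)"
proof -
  have "green_kernel r (j + 1) k + green_kernel r (j - 1) k - (r + inverse r) * green_kernel r j k
     = (r ^ nat \<bar>(j - k) + 1\<bar> + (r ^ nat \<bar>(j - k) - 1\<bar>) - (r + inverse r) * r ^ nat \<bar>j - k\<bar>)
     - (r ^ nat \<bar>j + 1\<bar> + (r ^ nat \<bar>j - 1\<bar>) - (r + inverse r) * r ^ nat \<bar>j\<bar>) * r ^ nat \<bar>k\<bar>"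
    unfolding green_kernel_def by (simp add: power_add algebra_simps)
  then show ?thesis
    using assms by (simp add: second_difference_power_abs)
qed

lemma green_kernel_zero: "green_kernel r 0 k = 0"
  by (simp add: green_kernel_def)

text \<open>At the node \<open>\<sigma> = 1\<close> or \<open>\<sigma> = -1\<close> next to the origin, on the same side as \<open>k\<close>, one has
  \<open>\<bar>\<sigma> - k\<bar> = \<bar>k\<bar> - 1\<close>. The kernel collapses to a multiple of \<open>r\<^bsup>\<bar>k\<bar>\<^esup>\<close>, which is how the
  functionals \<open>\<Sum>k. r\<^bsup>\<bar>k\<bar>\<^esup> g k\<close> enter the final formula.\<close>

lemma green_kernel_boundary:
  assumes "r \<noteq> 0" "\<bar>\<sigma>\<bar> = 1" "\<sigma> * k > 0"
  shows "green_kernel r \<sigma> k = - (r - inverse r) * r ^ nat \<bar>k\<bar>"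
proof -
  have "\<sigma> = 1 \<or> \<sigma> = -1" using assms(2) by auto
  then have "nat \<bar>\<sigma> - k\<bar> = nat \<bar>k\<bar> - 1" "nat \<bar>k\<bar> \<noteq> 0" using assms(3) by auto
  then obtain m where m: "nat \<bar>\<sigma> - k\<bar> = m" "nat \<bar>k\<bar> = Suc m" by (cases "nat \<bar>k\<bar>") auto
  show ?thesis unfolding green_kernel_def m using assms by (simp add: field_simps)
qed

lemma norm_green_kernel_le:
  assumes "cmod r < 1"
  shows "cmod (green_kernel r j k) \<le> 2 * cmod r ^ nat \<bar>j - k\<bar>"
proof -
  have "cmod (green_kernel r j k) \<le> cmod r ^ nat \<bar>j - k\<bar> + cmod r ^ (nat \<bar>j\<bar> + nat \<bar>k\<bar>)"
    unfolding green_kernel_def by (metis norm_power norm_triangle_ineq4)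
  also have "cmod r ^ (nat \<bar>j\<bar> + nat \<bar>k\<bar>) \<le> cmod r ^ nat \<bar>j - k\<bar>"
    using assms by (intro power_decreasing) auto
  finally show ?thesis by simp
qed

lemma finite_sum_green_kernel_le:
  assumes "cmod r < 1" "finite F"
  shows "(\<Sum>k\<in>F. cmod (green_kernel r j k)) \<le> 2 * (\<Sum>\<^sub>\<infinity>k::int. cmod r ^ nat \<bar>k\<bar>)"
    and "(\<Sum>j\<in>F. cmod (green_kernel r j k)) \<le> 2 * (\<Sum>\<^sub>\<infinity>k::int. cmod r ^ nat \<bar>k\<bar>)"
proof -
  have row: "(\<Sum>k\<in>F. cmod (green_kernel r j k)) \<le> 2 * (\<Sum>\<^sub>\<infinity>k::int. cmod r ^ nat \<bar>k\<bar>)" for j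
  proof -
    have "(\<Sum>k\<in>F. cmod (green_kernel r j k)) \<le> (\<Sum>k\<in>F. 2 * cmod r ^ nat \<bar>j - k\<bar>)"
      using assms by (intro sum_mono norm_green_kernel_le)
    also have "\<dots> \<le> 2 * (\<Sum>\<^sub>\<infinity>k::int. cmod r ^ nat \<bar>k\<bar>)"
      using finite_sum_power_dist_le[of "cmod r" F j] assms
      by (simp add: sum_distrib_left[symmetric])
    finally show ?thesis .
  qed
  show "(\<Sum>k\<in>F. cmod (green_kernel r j k)) \<le> 2 * (\<Sum>\<^sub>\<infinity>k::int. cmod r ^ nat \<bar>k\<bar>)" by (rule row)
  have "green_kernel r j k = green_kernel r k j" for j
    by (simp add: green_kernel_def abs_minus_commute add.commute)
  then show "(\<Sum>j\<in>F. cmod (green_kernel r j k)) \<le> 2 * (\<Sum>\<^sub>\<infinity>k::int. cmod r ^ nat \<bar>k\<bar>)"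
    using row[of k] by simp
qed

lemma summable_on_power_abs_times:
  assumes "cmod r < 1" and "(\<lambda>k. (cmod (g k))\<^sup>2) summable_on H"
  shows "(\<lambda>k. r ^ nat \<bar>k\<bar> * g k) summable_on H"
proof -
  have "(\<lambda>k. norm (r ^ nat \<bar>k\<bar> * g k)) summable_on H"
    by (rule schur_row_summable(2)[OF _ assms(2)])
      (use finite_sum_power_dist_le[of "cmod r" _ 0] assms(1) in \<open>simp add: norm_power\<close>)
  then show ?thesis by (rule abs_summable_summable)
qed

lemma summable_on_green_kernel_times:
  assumes "cmod r < 1" and "(\<lambda>k. (cmod (g k))\<^sup>2) summable_on H"
  shows "(\<lambda>k. green_kernel r j k * g k) summable_on H"
  by (rule abs_summable_summable, rule schur_row_summable(2)[OF _ assms(2)])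
    (rule finite_sum_green_kernel_le(1)[OF assms(1)])

text \<open>The Dirichlet solution operator of the recurrence
  \<open>F (j + 1) + F (j - 1) - (r + inverse r) F j = g j\<close>; the divisor is what the left-hand side takes as
  value at \<open>j = 0\<close> when \<open>F j = r\<^bsup>\<bar>j\<bar>\<^esup>\<close>.\<close>

definition green_op :: "complex \<Rightarrow> int set \<Rightarrow> (int \<Rightarrow> complex) \<Rightarrow> int \<Rightarrow> complex" where
  "green_op r H g j = (\<Sum>\<^sub>\<infinity>k\<in>H. green_kernel r j k * g k) / (r - inverse r)"

lemma green_op_zero: "green_op r H g 0 = 0"
  by (simp add: green_op_def green_kernel_zero)

lemma green_op_square_summable:
  assumes r: "cmod r < 1" and g: "(\<lambda>k. (cmod (g k))\<^sup>2) summable_on H"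
  shows "(\<lambda>j. (cmod (green_op r H g j))\<^sup>2) summable_on H"
proof -
  have "(\<lambda>j. (cmod (\<Sum>\<^sub>\<infinity>k\<in>H. green_kernel r j k * g k))\<^sup>2) summable_on H"
    by (rule schur_test[OF _ _ g]) (use r finite_sum_green_kernel_le in blast)+
  from summable_on_cmult_right[OF this, of "inverse ((cmod (r - inverse r))\<^sup>2)"]
  show ?thesis
    by (simp add: green_op_def norm_divide norm_mult norm_inverse power_mult_distrib power_inverse
        divide_inverse mult.commute)
qed

lemma green_op_second_difference:
  assumes "r \<noteq> 0" "cmod r < 1" and g: "(\<lambda>k. (cmod (g k))\<^sup>2) summable_on H"
    and "j \<in> H" "j \<noteq> 0"
  shows "green_op r H g (j + 1) + green_op r H g (j - 1) - (r + inverse r) * green_op r H g j = g j"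
proof -
  define q where "q = r - inverse r"
  have "q \<noteq> 0" using minus_inverse_nonzero assms unfolding q_def by blast
  note summ = summable_on_green_kernel_times[OF assms(2) g]
  let ?K = "\<lambda>i. \<Sum>\<^sub>\<infinity>k\<in>H. green_kernel r i k * g k"
  have "?K (j + 1) + ?K (j - 1) + - (r + inverse r) * ?K j
      = (\<Sum>\<^sub>\<infinity>k\<in>H. green_kernel r (j + 1) k * g k + green_kernel r (j - 1) k * g k
          + - (r + inverse r) * (green_kernel r j k * g k))"
    by (simp only: infsum_add infsum_cmult_right summ summable_on_add
        summable_on_cmult_right)
  also have "\<dots> = (\<Sum>\<^sub>\<infinity>k\<in>H. if k = j then q * g j else 0)"
  proof (rule infsum_cong)
    fix k
    have "green_kernel r (j + 1) k * g k + green_kernel r (j - 1) k * g k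
        + - (r + inverse r) * (green_kernel r j k * g k)
      = (green_kernel r (j + 1) k + green_kernel r (j - 1) k
        - (r + inverse r) * green_kernel r j k) * g k"
      by (simp add: algebra_simps)
    then show "green_kernel r (j + 1) k * g k + green_kernel r (j - 1) k * g k
        + - (r + inverse r) * (green_kernel r j k * g k) = (if k = j then q * g j else 0)"
      unfolding green_kernel_second_difference[OF assms(1,5)] by (simp add: q_def)
  qed
  also have "\<dots> = (\<Sum>\<^sub>\<infinity>k\<in>{j}. q * g j)"
    using \<open>j \<in> H\<close> by (intro infsum_cong_neutral) auto
  also have "\<dots> = q * g j" by simp
  finally have "?K (j + 1) + ?K (j - 1) + - (r + inverse r) * ?K j = q * g j" .
  then have *: "?K (j + 1) + ?K (j - 1) - (r + inverse r) * ?K j = q * g j"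
    by (simp only: mult_minus_left diff_conv_add_uminus)
  have "green_op r H g (j + 1) + green_op r H g (j - 1) - (r + inverse r) * green_op r H g j
     = (?K (j + 1) + ?K (j - 1) - (r + inverse r) * ?K j) / q"
    unfolding green_op_def q_def by (simp add: diff_divide_distrib add_divide_distrib)
  then show ?thesis unfolding * using \<open>q \<noteq> 0\<close> by simp
qed

lemma green_op_boundary:
  assumes "r \<noteq> 0" "cmod r < 1" "\<bar>\<sigma>\<bar> = 1" "\<And>k. k \<in> H \<Longrightarrow> \<sigma> * k > 0"
  shows "green_op r H g \<sigma> = - (\<Sum>\<^sub>\<infinity>k\<in>H. r ^ nat \<bar>k\<bar> * g k)"
proof -
  have q: "r - inverse r \<noteq> 0" by (rule minus_inverse_nonzero[OF assms(1,2)])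
  have "(\<Sum>\<^sub>\<infinity>k\<in>H. green_kernel r \<sigma> k * g k)
      = (\<Sum>\<^sub>\<infinity>k\<in>H. - (r - inverse r) * (r ^ nat \<bar>k\<bar> * g k))"
    by (rule infsum_cong) (simp only: green_kernel_boundary[OF assms(1,3,4)] mult.assoc)
  also have "\<dots> = - (r - inverse r) * (\<Sum>\<^sub>\<infinity>k\<in>H. r ^ nat \<bar>k\<bar> * g k)"
    by (rule infsum_cmult_right') 
  finally show ?thesis unfolding green_op_def
    by (simp only: mult_minus_left minus_divide_left[symmetric] nonzero_mult_div_cancel_left[OF q])
qed

section \<open>Square-summable solutions on a half-line\<close>

lemma Zhalf_iff: "j \<in> Zhalf s \<longleftrightarrow> (if s = 1 then j < 0 else j > 0)"
  by (auto simp: Zhalf_def)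

lemma square_summable_add:
  fixes f g :: "'i \<Rightarrow> complex"
  assumes "(\<lambda>k. (cmod (f k))\<^sup>2) summable_on H" "(\<lambda>k. (cmod (g k))\<^sup>2) summable_on H"
  shows "(\<lambda>k. (cmod (f k + g k))\<^sup>2) summable_on H"
proof (rule summable_on_comparison_test)
  show "(\<lambda>k. 2 * (cmod (f k))\<^sup>2 + 2 * (cmod (g k))\<^sup>2) summable_on H"
    using assms by (intro summable_on_add summable_on_cmult_right)
  fix k
  have "(cmod (f k + g k))\<^sup>2 \<le> (cmod (f k) + cmod (g k))\<^sup>2"
    by (intro power_mono norm_triangle_ineq) simp
  also have "\<dots> \<le> 2 * (cmod (f k))\<^sup>2 + 2 * (cmod (g k))\<^sup>2"
    using zero_le_power2[of "cmod (f k) - cmod (g k)"]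
    by (simp add: power2_eq_square algebra_simps)
  finally show "(cmod (f k + g k))\<^sup>2 \<le> 2 * (cmod (f k))\<^sup>2 + 2 * (cmod (g k))\<^sup>2" .
qed simp

lemma square_summable_cmult:
  fixes f :: "'i \<Rightarrow> complex"
  assumes "(\<lambda>k. (cmod (f k))\<^sup>2) summable_on H"
  shows "(\<lambda>k. (cmod (c * f k))\<^sup>2) summable_on H"
  using summable_on_cmult_right[OF assms, of "(cmod c)\<^sup>2"]
  by (simp add: norm_mult power_mult_distrib)

lemma square_summable_power_abs:
  fixes H :: "int set"
  assumes "cmod r < 1"
  shows "(\<lambda>k. (cmod (r ^ nat \<bar>k\<bar>))\<^sup>2) summable_on H"
proof -
  have "(cmod r)\<^sup>2 < 1" using assms by (simp add: power_less_one_iff)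
  then have "(\<lambda>k::int. ((cmod r)\<^sup>2) ^ nat \<bar>k\<bar>) summable_on UNIV"
    by (intro summable_on_power_abs) auto
  then have "(\<lambda>k::int. (cmod (r ^ nat \<bar>k\<bar>))\<^sup>2) summable_on UNIV"
    by (simp add: norm_power power_mult[symmetric] mult.commute)
  then show ?thesis by (rule summable_on_subset_banach) simp
qed

text \<open>The second-order recurrence factors as (shift \<open>- r\<inverse>\<close>)(shift \<open>- r\<close>). Hence
  \<open>w (n + 1) - r w n\<close> is multiplied by \<open>r\<inverse>\<close>, of modulus greater than one, at each step, and
  can only tend to zero if it vanishes.\<close>

lemma decaying_recurrence_zero:
  fixes w :: "nat \<Rightarrow> complex"
  assumes r: "r \<noteq> 0" "cmod r < 1"
    and rec: "\<And>n. w (Suc (Suc n)) + w n = (r + inverse r) * w (Suc n)"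
    and init: "w 0 = 0" and lim: "w \<longlonglongrightarrow> 0"
  shows "w n = 0"
proof -
  define v where "v n = w (Suc n) - r * w n" for n
  have v_step: "v n = r * v (Suc n)" for n
  proof -
    have "r * (w (Suc (Suc n)) + w n) = (r * r + r * inverse r) * w (Suc n)"
      unfolding rec by (simp add: ring_distribs)
    also have "\<dots> = r * (r * w (Suc n)) + w (Suc n)"
      using r(1) by (simp add: ring_distribs)
    finally show ?thesis unfolding v_def by (simp add: algebra_simps)
  qed
  have v0: "v 0 = r ^ n * v n" for n
  proof (induction n)
    case (Suc n)
    then show ?case using v_step[of n] by (simp add: algebra_simps)
  qed simp
  have "(\<lambda>n. w (Suc n) - r * w n) \<longlonglongrightarrow> 0 - r * 0"
    by (intro tendsto_intros lim LIMSEQ_Suc)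
  then have "v \<longlonglongrightarrow> 0" by (simp add: v_def[abs_def])
  then have "(\<lambda>n. r ^ n * v n) \<longlonglongrightarrow> 0 * 0"
    using r(2) by (intro tendsto_mult LIMSEQ_power_zero) auto
  then have "(\<lambda>n::nat. v 0) \<longlonglongrightarrow> 0" by (simp add: v0[symmetric])
  then have "v 0 = 0" by (simp add: LIMSEQ_const_iff)
  then have "v n = 0" for n using v0[of n] r(1) by simp
  then have "w (Suc n) = r * w n" for n by (simp add: v_def)
  then show ?thesis using init by (induction n) auto
qed

lemma half_line_homogeneous_zero:
  assumes r: "r \<noteq> 0" "cmod r < 1"
    and rec: "\<And>j. j \<in> Zhalf s \<Longrightarrow> W (j + 1) + W (j - 1) = (r + inverse r) * W j"
    and W0: "W 0 = 0" and summ: "(\<lambda>j. (cmod (W j))\<^sup>2) summable_on Zhalf s"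
    and j: "j \<in> Zhalf s"
  shows "W j = 0"
proof -
  \<comment> \<open>The equation is invariant under reflection, so both halves reduce to a sequence on the naturals.\<close>
  define \<sigma> :: int where "\<sigma> = (if s = 1 then -1 else 1)"
  define w where "w n = W (\<sigma> * int n)" for n
  have in_half: "\<sigma> * int (Suc n) \<in> Zhalf s" for n by (simp add: Zhalf_iff \<sigma>_def)
  have w_rec: "w (Suc (Suc n)) + w n = (r + inverse r) * w (Suc n)" for n
    using rec[OF in_half[of n]] by (cases "s = 1") (simp_all add: w_def \<sigma>_def algebra_simps)
  have "inj (\<lambda>n. \<sigma> * int (Suc n))" by (auto simp: inj_on_def \<sigma>_def)
  moreover have "(\<lambda>j. (cmod (W j))\<^sup>2) summable_on range (\<lambda>n. \<sigma> * int (Suc n))"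
    using in_half by (intro summable_on_subset_banach[OF summ]) auto
  ultimately have "((\<lambda>j. (cmod (W j))\<^sup>2) \<circ> (\<lambda>n. \<sigma> * int (Suc n))) summable_on UNIV"
    by (simp only: summable_on_reindex)
  then have "(\<lambda>n. (cmod (w (Suc n)))\<^sup>2) summable_on UNIV" by (simp add: o_def w_def)
  then have "summable (\<lambda>n. (cmod (w (Suc n)))\<^sup>2)" by (rule summable_on_imp_summable)
  then have "(\<lambda>n. (cmod (w (Suc n)))\<^sup>2) \<longlonglongrightarrow> 0" by (rule summable_LIMSEQ_zero)
  then have "(\<lambda>n. sqrt ((cmod (w (Suc n)))\<^sup>2)) \<longlonglongrightarrow> sqrt 0" by (rule tendsto_real_sqrt)
  then have "(\<lambda>n. w (Suc n)) \<longlonglongrightarrow> 0" by (simp add: tendsto_norm_zero_iff)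
  then have "w \<longlonglongrightarrow> 0" by (rule LIMSEQ_imp_Suc)
  with decaying_recurrence_zero[OF r, of w] w_rec W0 have "w n = 0" for n
    by (simp add: w_def)
  moreover have "j = \<sigma> * int (nat \<bar>j\<bar>)" using j by (auto simp: Zhalf_iff \<sigma>_def split: if_splits)
  ultimately show ?thesis unfolding w_def by metis
qed

lemma half_line_solves:
  assumes r: "r \<noteq> 0" "cmod r < 1" and g: "(\<lambda>k. (cmod (g k))\<^sup>2) summable_on Zhalf s"
    and j: "j \<in> Zhalf s"
    and F_def: "\<And>j. F j = u * r ^ nat \<bar>j\<bar> + green_op r (Zhalf s) g j"
  shows "F (j + 1) + F (j - 1) - (r + inverse r) * F j = g j"
proof -
  have "j \<noteq> 0" using j by (auto simp: Zhalf_iff split: if_splits)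
  have "F (j + 1) + F (j - 1) - (r + inverse r) * F j
     = u * (r ^ nat \<bar>j + 1\<bar> + (r ^ nat \<bar>j - 1\<bar>) - (r + inverse r) * r ^ nat \<bar>j\<bar>)
     + (green_op r (Zhalf s) g (j + 1) + green_op r (Zhalf s) g (j - 1)
        - (r + inverse r) * green_op r (Zhalf s) g j)"
    unfolding F_def by (simp add: algebra_simps)
  then show ?thesis
    using second_difference_power_abs[OF r(1), of j]
      green_op_second_difference[OF r g j \<open>j \<noteq> 0\<close>] \<open>j \<noteq> 0\<close>
    by simp
qed

lemma half_line_square_summable:
  assumes "cmod r < 1" "(\<lambda>k. (cmod (g k))\<^sup>2) summable_on H"
  shows "(\<lambda>j. (cmod (u * r ^ nat \<bar>j\<bar> + green_op r H g j))\<^sup>2) summable_on H"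
  using assms
  by (intro square_summable_add square_summable_cmult square_summable_power_abs
      green_op_square_summable)

lemma half_line_unique:
  assumes r: "r \<noteq> 0" "cmod r < 1" and g: "(\<lambda>k. (cmod (g k))\<^sup>2) summable_on Zhalf s"
    and rec: "\<And>j. j \<in> Zhalf s \<Longrightarrow> F (j + 1) + F (j - 1) - (r + inverse r) * F j = g j"
    and F: "(\<lambda>k. (cmod (F k))\<^sup>2) summable_on Zhalf s"
    and j: "j \<in> Zhalf s"
  shows "F j = F 0 * r ^ nat \<bar>j\<bar> + green_op r (Zhalf s) g j"
proof -
  define E where "E j = F 0 * r ^ nat \<bar>j\<bar> + green_op r (Zhalf s) g j" for j
  define W where "W j = F j + (-1) * E j" for j
  have E_rec: "E (j + 1) + E (j - 1) - (r + inverse r) * E j = g j" if "j \<in> Zhalf s" for j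
    using half_line_solves[OF r g that] E_def by blast
  have "W j = 0"
  proof (rule half_line_homogeneous_zero[OF r _ _ _ j])
    fix i assume i: "i \<in> Zhalf s"
    show "W (i + 1) + W (i - 1) = (r + inverse r) * W i"
      using rec[OF i] E_rec[OF i] by (simp add: W_def algebra_simps)
  next
    show "W 0 = 0" by (simp add: W_def E_def green_op_zero)
  next
    have "(\<lambda>k. (cmod (E k))\<^sup>2) summable_on Zhalf s"
      unfolding E_def by (rule half_line_square_summable[OF r(2) g])
    then show "(\<lambda>k. (cmod (W k))\<^sup>2) summable_on Zhalf s"
      unfolding W_def by (intro square_summable_add square_summable_cmult F)
  qed
  then have "F j = E j" by (simp add: W_def)
  then show ?thesis by (simp only: E_def)
qed

section \<open>The transmission condition at the interface\<close>

text \<open>The bond between \<open>-1\<close> and \<open>1\<close> has resistance \<open>b\<^sub>1\<^sup>2 + b\<^sub>2\<^sup>2\<close>, which is that of two bonds in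
  series through an extra node at \<open>0\<close>. The value below is the one at which the currents through that
  node balance; with it inserted, the operator becomes a plain second difference on either side.\<close>

definition interface_value :: "(nat \<Rightarrow> real) \<Rightarrow> (int \<Rightarrow> complex) \<Rightarrow> complex" where
  "interface_value b f =
     (complex_of_real ((b 2)\<^sup>2) * f (-1) + complex_of_real ((b 1)\<^sup>2) * f 1)
       / complex_of_real ((b 1)\<^sup>2 + (b 2)\<^sup>2)"

lemma interface_value_eq_iff:
  assumes "b 1 > 0" "b 2 > 0"
  shows "interface_value b f = u \<longleftrightarrow>
    complex_of_real (1 / (b 1)\<^sup>2) * (f (-1) - u) + complex_of_real (1 / (b 2)\<^sup>2) * (f 1 - u) = 0"
proof -
  have nz: "complex_of_real ((b 1)\<^sup>2) \<noteq> 0" "complex_of_real ((b 2)\<^sup>2) \<noteq> 0"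
    "complex_of_real ((b 1)\<^sup>2) + complex_of_real ((b 2)\<^sup>2) \<noteq> 0"
    using assms add_pos_pos[of "(b 1)\<^sup>2" "(b 2)\<^sup>2"]
    unfolding of_real_add[symmetric] of_real_eq_0_iff by auto
  define B1 B2 where "B1 = complex_of_real ((b 1)\<^sup>2)" and "B2 = complex_of_real ((b 2)\<^sup>2)"
  note nz = nz[folded B1_def B2_def]
  have "interface_value b f = u \<longleftrightarrow> B2 * f (-1) + B1 * f 1 = u * (B1 + B2)"
    unfolding interface_value_def of_real_add B1_def[symmetric] B2_def[symmetric]
    by (rule divide_eq_eq[THEN trans]) (use nz in simp)
  also have "\<dots> \<longleftrightarrow> 1 / B1 * (f (-1) - u) + 1 / B2 * (f 1 - u) = 0"
  proof -
    have "1 / B1 * (f (-1) - u) + 1 / B2 * (f 1 - u) = (B2 * f (-1) + B1 * f 1 - u * (B1 + B2)) / (B1 * B2)"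
      using nz(1,2) by (simp add: divide_simps) (simp add: ring_distribs)
    then show ?thesis using nz(1,2) by simp
  qed
  finally show ?thesis unfolding B1_def B2_def by simp
qed

lemma opA_eq_second_difference:
  fixes b :: "nat \<Rightarrow> real" and f :: "int \<Rightarrow> complex"
  assumes b: "b 1 > 0" "b 2 > 0" and s: "s \<in> {1, 2}" and j: "j \<in> Zhalf s"
    and F_def: "F = f(0 := interface_value b f)"
  shows "opA b f j = complex_of_real (1 / (b s)\<^sup>2) * (F (j + 1) - 2 * F j + F (j - 1))"
proof -
  define B1 B2 where "B1 = complex_of_real ((b 1)\<^sup>2)" and "B2 = complex_of_real ((b 2)\<^sup>2)"
  have nz: "B1 \<noteq> 0" "B2 \<noteq> 0" using b by (simp_all add: B1_def B2_def)
  have "(b 1)\<^sup>2 + (b 2)\<^sup>2 \<noteq> 0" using b by (metis add_pos_pos less_imp_neq zero_less_power)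
  then have nz': "B1 + B2 \<noteq> 0" unfolding B1_def B2_def of_real_add[symmetric] by (simp only: of_real_eq_0_iff) simp
  have conv: "complex_of_real (1 / (b 1)\<^sup>2) = 1 / B1" "complex_of_real (1 / (b 2)\<^sup>2) = 1 / B2"
    "complex_of_real (1 / ((b 1)\<^sup>2 + (b 2)\<^sup>2)) = 1 / (B1 + B2)"
    by (simp_all add: B1_def B2_def)
  have F0: "F 0 = (B2 * f (-1) + B1 * f 1) / (B1 + B2)"
    by (simp add: F_def interface_value_def B1_def B2_def)
  have Fn: "F i = f i" if "i \<noteq> 0" for i using that by (simp add: F_def)
  have left: "(F 0 - f (-1)) / B1 = (f 1 - f (-1)) / (B1 + B2)"
    and right: "(F 0 - f 1) / B2 = (f (-1) - f 1) / (B1 + B2)"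
    using nz nz' unfolding F0 by (simp_all add: divide_simps) (simp_all add: algebra_simps)
  consider "s = 1" "j \<le> -2" | "s = 1" "j = -1" | "s = 2" "j = 1" | "s = 2" "j \<ge> 2"
    using s j by (force simp: Zhalf_iff)
  then show ?thesis
  proof cases
    case 1
    then show ?thesis by (simp add: opA_def Fn)
  next
    case 2
    have "opA b f j = 1 / B1 * f (-2) - 1 / B1 * f (-1) + (f 1 - f (-1)) / (B1 + B2)"
      unfolding 2 opA_def Let_def conv by (simp add: diff_divide_distrib ring_distribs)
    also have "\<dots> = 1 / B1 * (F 0 - 2 * f (-1) + f (-2))"
      unfolding left[symmetric] by (simp add: diff_divide_distrib add_divide_distrib)
    finally show ?thesis unfolding 2 conv by (simp add: Fn)
  next
    case 3
    have "opA b f j = 1 / B2 * f 2 - 1 / B2 * f 1 + (f (-1) - f 1) / (B1 + B2)"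
      unfolding 3 opA_def Let_def conv by (simp add: diff_divide_distrib ring_distribs)
    also have "\<dots> = 1 / B2 * (f 2 - 2 * f 1 + F 0)"
      unfolding right[symmetric] by (simp add: diff_divide_distrib add_divide_distrib)
    finally show ?thesis unfolding 3 conv by (simp add: Fn)
  next
    case 4
    then show ?thesis by (simp add: opA_def Fn)
  qed
qed

lemma Zstar_eq: "Zstar = Zhalf 1 \<union> Zhalf 2"
  by (auto simp: Zstar_def Zhalf_def)

lemma l2_Zstar_iff:
  "f \<in> l2 Zstar \<longleftrightarrow> f 0 = 0 \<and> (\<forall>s\<in>{1, 2}. (\<lambda>j. (cmod (f j))\<^sup>2) summable_on Zhalf s)"
proof -
  have "(\<lambda>j. (cmod (f j))\<^sup>2) summable_on Zstar \<longleftrightarrow>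
      (\<forall>s\<in>{1, 2}. (\<lambda>j. (cmod (f j))\<^sup>2) summable_on Zhalf s)"
    unfolding Zstar_eq by (auto intro: summable_on_union summable_on_subset_banach)
  then show ?thesis by (auto simp: l2_def Zstar_def)
qed

text \<open>Dividing the difference equation by \<open>1 / (b s)\<^sup>2\<close> turns \<open>lam\<close> into
  \<open>r s + inverse (r s) - 2\<close>, which explains both the shape of the recurrence and the factor in front
  of \<open>g\<close>.\<close>

lemma resolvent_equation_iff:
  assumes b: "b 1 > 0" "b 2 > 0"
    and root: "\<And>s. s \<in> {1, 2} \<Longrightarrow> is_small_root (b s) lam (r s)"
    and zero: "f 0 = 0" "g 0 = 0" and F_def: "F = f(0 := interface_value b f)"
  shows "(\<lambda>j. opA b f j - lam * f j) = g \<longleftrightarrow>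
    (\<forall>s\<in>{1, 2}. \<forall>j\<in>Zhalf s. F (j + 1) + F (j - 1) - (r s + inverse (r s)) * F j
        = complex_of_real ((b s)\<^sup>2) * g j)"
proof -
  have pointwise: "opA b f j - lam * f j = g j \<longleftrightarrow>
      F (j + 1) + F (j - 1) - (r s + inverse (r s)) * F j = complex_of_real ((b s)\<^sup>2) * g j"
    if s: "s \<in> {1, 2}" and j: "j \<in> Zhalf s" for s j
  proof -
    have bs: "b s > 0" using s b by auto
    have "j \<noteq> 0" using j by (auto simp: Zhalf_iff split: if_splits)
    then have "opA b f j - lam * f j = complex_of_real (1 / (b s)\<^sup>2) * (F (j + 1) - 2 * F j + F (j - 1))
        - complex_of_real (1 / (b s)\<^sup>2) * (r s + inverse (r s) - 2) * F j"
      using opA_eq_second_difference[OF b s j F_def] lam_eq_small_root[OF bs root[OF s]]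
      by (simp add: F_def)
    also have "\<dots> = (F (j + 1) + F (j - 1) - (r s + inverse (r s)) * F j) / complex_of_real ((b s)\<^sup>2)"
      using bs by (simp add: divide_simps) (simp add: algebra_simps)
    finally have "opA b f j - lam * f j = g j \<longleftrightarrow>
      (F (j + 1) + F (j - 1) - (r s + inverse (r s)) * F j) / complex_of_real ((b s)\<^sup>2) = g j"
      by simp
    also have "\<dots> \<longleftrightarrow> F (j + 1) + F (j - 1) - (r s + inverse (r s)) * F j
        = complex_of_real ((b s)\<^sup>2) * g j"
      using bs by (subst divide_eq_eq) (simp add: mult.commute)
    finally show ?thesis .
  qed
  have "opA b f 0 - lam * f 0 = g 0" using zero by (simp add: opA_def)
  moreover have "j = 0 \<or> j \<in> Zhalf 1 \<or> j \<in> Zhalf 2" for j by (auto simp: Zhalf_iff)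
  ultimately have "(\<lambda>j. opA b f j - lam * f j) = g \<longleftrightarrow>
      (\<forall>s\<in>{1, 2}. \<forall>j\<in>Zhalf s. opA b f j - lam * f j = g j)"
    unfolding fun_eq_iff by (metis insertCI)
  then show ?thesis using pointwise by blast
qed

section \<open>Existence and uniqueness for the coupled problem\<close>

text \<open>The parameter \<open>u\<close> is the value at the origin, common to both halves and still to be determined.\<close>

definition resolvent_formula ::
  "(nat \<Rightarrow> real) \<Rightarrow> (nat \<Rightarrow> complex) \<Rightarrow> (int \<Rightarrow> complex) \<Rightarrow> complex \<Rightarrow> nat \<Rightarrow> int \<Rightarrow> complex" where
  "resolvent_formula b r g u s j =
     u * r s ^ nat \<bar>j\<bar> + green_op (r s) (Zhalf s) (\<lambda>k. complex_of_real ((b s)\<^sup>2) * g k) j"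

text \<open>At the neighbours of the origin the formula gives \<open>u r s - (b s)\<^sup>2 S s\<close>, where \<open>S s\<close> is the
  boundary functional of \<open>g\<close> on the half \<open>s\<close>. Inserting this into the current balance at the origin
  makes the factors \<open>(b s)\<^sup>2\<close> cancel and leaves \<open>u D + S 1 + S 2 = 0\<close>.\<close>

lemma balance_iff:
  assumes b: "b 1 > 0" "b 2 > 0"
    and r: "\<And>s. s \<in> {1, 2} \<Longrightarrow> r s \<noteq> 0 \<and> cmod (r s) < 1"
    and D_def: "D = complex_of_real (1 / (b 2)\<^sup>2) * (1 - r 2) + complex_of_real (1 / (b 1)\<^sup>2) * (1 - r 1)"
    and "D \<noteq> 0"
    and f: "f (-1) = resolvent_formula b r g u 1 (-1)" "f 1 = resolvent_formula b r g u 2 1"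
  shows "interface_value b f = u \<longleftrightarrow>
    u = - ((\<Sum>\<^sub>\<infinity>k\<in>Zhalf 1. r 1 ^ nat \<bar>k\<bar> * g k) + (\<Sum>\<^sub>\<infinity>k\<in>Zhalf 2. r 2 ^ nat \<bar>k\<bar> * g k)) / D"
proof -
  define S where "S s = (\<Sum>\<^sub>\<infinity>k\<in>Zhalf s. r s ^ nat \<bar>k\<bar> * g k)" for s
  have edge: "resolvent_formula b r g u s \<sigma> = u * r s - complex_of_real ((b s)\<^sup>2) * S s"
    if s: "s \<in> {1, 2}" and \<sigma>: "\<bar>\<sigma>\<bar> = 1" "\<sigma> \<in> Zhalf s" for s \<sigma>
  proof -
    have "green_op (r s) (Zhalf s) (\<lambda>k. complex_of_real ((b s)\<^sup>2) * g k) \<sigma>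
        = - (\<Sum>\<^sub>\<infinity>k\<in>Zhalf s. r s ^ nat \<bar>k\<bar> * (complex_of_real ((b s)\<^sup>2) * g k))"
      using r[OF s] \<sigma> by (intro green_op_boundary)
        (auto simp: Zhalf_iff mult_neg_neg split: if_splits)
    also have "\<dots> = - (complex_of_real ((b s)\<^sup>2) * S s)"
      unfolding S_def by (subst infsum_cmult_right'[symmetric]) (simp add: mult.left_commute)
    finally show ?thesis using \<sigma>(1) by (simp add: resolvent_formula_def)
  qed
  have f1: "f (-1) = u * r 1 - complex_of_real ((b 1)\<^sup>2) * S 1"
    and f2: "f 1 = u * r 2 - complex_of_real ((b 2)\<^sup>2) * S 2"
    unfolding f by (rule edge; simp add: Zhalf_iff)+
  have "complex_of_real (1 / (b 1)\<^sup>2) * (f (-1) - u) + complex_of_real (1 / (b 2)\<^sup>2) * (f 1 - u)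
      = - (u * D + (S 1 + S 2))"
  proof -
    have c: "complex_of_real (1 / (b 1)\<^sup>2) * complex_of_real ((b 1)\<^sup>2) = 1"
      "complex_of_real (1 / (b 2)\<^sup>2) * complex_of_real ((b 2)\<^sup>2) = 1"
      using b by simp_all
    have "complex_of_real (1 / (b 1)\<^sup>2) * (f (-1) - u) + complex_of_real (1 / (b 2)\<^sup>2) * (f 1 - u)
      = - (u * D) - (complex_of_real (1 / (b 1)\<^sup>2) * complex_of_real ((b 1)\<^sup>2)) * S 1
        - (complex_of_real (1 / (b 2)\<^sup>2) * complex_of_real ((b 2)\<^sup>2)) * S 2"
      unfolding f1 f2 D_def by algebra
    then show ?thesis unfolding c by simp
  qed
  then have "interface_value b f = u \<longleftrightarrow> u * D + (S 1 + S 2) = 0"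
    using interface_value_eq_iff[of b f u] b by (metis neg_equal_0_iff_equal)
  also have "\<dots> \<longleftrightarrow> u = - (S 1 + S 2) / D"
    using \<open>D \<noteq> 0\<close> by (simp add: field_simps eq_neg_iff_add_eq_0)
  finally show ?thesis unfolding S_def .
qed

text \<open>Both directions rest on \<open>balance_iff\<close>: for a solution, \<open>half_line_unique\<close> yields the formula with
  its interface value in place of \<open>u\<close>, which the balance then identifies; conversely the balance shows
  that the interface value of the formula is the \<open>u\<close> that it contains, so that the pieces fit together.\<close>

lemma resolvent_solution_iff:
  assumes b: "b 1 > 0" "b 2 > 0"
    and root: "\<And>s. s \<in> {1, 2} \<Longrightarrow> is_small_root (b s) lam (r s)"
    and D_def: "D = complex_of_real (1 / (b 2)\<^sup>2) * (1 - r 2) + complex_of_real (1 / (b 1)\<^sup>2) * (1 - r 1)"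
    and D: "D \<noteq> 0" and g: "g \<in> l2 Zstar"
    and u_def: "u = - ((\<Sum>\<^sub>\<infinity>k\<in>Zhalf 1. r 1 ^ nat \<bar>k\<bar> * g k)
      + (\<Sum>\<^sub>\<infinity>k\<in>Zhalf 2. r 2 ^ nat \<bar>k\<bar> * g k)) / D"
  shows "f \<in> l2 Zstar \<and> (\<lambda>j. opA b f j - lam * f j) = g \<longleftrightarrow>
    f 0 = 0 \<and> (\<forall>s\<in>{1, 2}. \<forall>j\<in>Zhalf s. f j = resolvent_formula b r g u s j)"
    (is "?sol \<longleftrightarrow> ?formula")
proof -
  let ?h = "\<lambda>s k. complex_of_real ((b s)\<^sup>2) * g k"
  have r: "r s \<noteq> 0 \<and> cmod (r s) < 1" if "s \<in> {1, 2}" for s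
    using root[OF that] is_small_root_nonzero is_small_root_def by blast
  have g0: "g 0 = 0" using g by (simp add: l2_Zstar_iff)
  have h: "(\<lambda>k. (cmod (?h s k))\<^sup>2) summable_on Zhalf s" if "s \<in> {1, 2}" for s
    using g that by (intro square_summable_cmult) (auto simp: l2_Zstar_iff)
  define F where "F = f(0 := interface_value b f)"
  have F_half: "F j = f j" if "j \<in> Zhalf s" for j s
    using that by (auto simp: F_def Zhalf_iff split: if_splits)
  have m1: "-1 \<in> Zhalf 1" and p1: "1 \<in> Zhalf 2" by (auto simp: Zhalf_iff)
  show ?thesis
  proof
    assume sol: ?sol
    then have f0: "f 0 = 0" and f: "\<And>s. s \<in> {1, 2} \<Longrightarrow> (\<lambda>j. (cmod (f j))\<^sup>2) summable_on Zhalf s"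
      by (auto simp: l2_Zstar_iff)
    have rec: "\<forall>s\<in>{1, 2}. \<forall>j\<in>Zhalf s. F (j + 1) + F (j - 1) - (r s + inverse (r s)) * F j = ?h s j"
      using sol resolvent_equation_iff[where f = f and g = g and r = r, OF b root f0 g0 F_def] by simp
    have fF: "f j = resolvent_formula b r g (F 0) s j" if s: "s \<in> {1, 2}" and j: "j \<in> Zhalf s" for s j
    proof -
      have "(\<lambda>j. (cmod (F j))\<^sup>2) summable_on Zhalf s"
        using f[OF s] F_half by (simp cong: summable_on_cong)
      then have "F j = F 0 * r s ^ nat \<bar>j\<bar> + green_op (r s) (Zhalf s) (?h s) j"
        using r[OF s] h[OF s] rec s j by (intro half_line_unique) auto
      then show ?thesis using F_half[OF j] by (simp add: resolvent_formula_def)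
    qed
    have "interface_value b f = F 0" by (simp add: F_def)
    then have "F 0 = u"
      unfolding u_def using balance_iff[OF b r D_def D fF[OF _ m1] fF[OF _ p1]] by simp
    then show ?formula using f0 fF by auto
  next
    assume formula: ?formula
    then have f0: "f 0 = 0"
      and fF: "\<And>s j. s \<in> {1, 2} \<Longrightarrow> j \<in> Zhalf s \<Longrightarrow> f j = resolvent_formula b r g u s j" by auto
    have "F 0 = u"
      using balance_iff[OF b r D_def D fF[OF _ m1] fF[OF _ p1]] u_def by (simp add: F_def)
    have rec: "F (j + 1) + F (j - 1) - (r s + inverse (r s)) * F j = ?h s j"
      if s: "s \<in> {1, 2}" and j: "j \<in> Zhalf s" for s j
    proof -
      \<comment> \<open>At \<open>0\<close> this agrees with either half because the Green term vanishes there.\<close>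
      have closed: "F i = resolvent_formula b r g u s i" if "i \<in> insert 0 (Zhalf s)" for i
        using that F_half fF[OF s] \<open>F 0 = u\<close>
        by (auto simp: resolvent_formula_def green_op_zero)
      have "j + 1 \<in> insert 0 (Zhalf s)" "j - 1 \<in> insert 0 (Zhalf s)" "j \<in> insert 0 (Zhalf s)"
        using j by (auto simp: Zhalf_iff split: if_splits)
      then show ?thesis
        using half_line_solves[of "r s" "?h s" s j "resolvent_formula b r g u s" u]
          r[OF s] h[OF s] j closed
        by (simp add: resolvent_formula_def)
    qed
    have "(\<lambda>j. (cmod (f j))\<^sup>2) summable_on Zhalf s" if s: "s \<in> {1, 2}" for s
      using half_line_square_summable[of "r s" "?h s" "Zhalf s" u] r[OF s] h[OF s] fF[OF s]
      by (simp add: resolvent_formula_def cong: summable_on_cong)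
    then have "f \<in> l2 Zstar" using f0 by (simp add: l2_Zstar_iff)
    then show ?sol using resolvent_equation_iff[where f = f and g = g and r = r, OF b root f0 g0 F_def] rec by simp
  qed
qed

theorem lemma4p3:
  fixes b :: "nat \<Rightarrow> real" and lam :: complex and r :: "nat \<Rightarrow> complex" and D :: complex
  assumes "b 1 > 0" and "b 2 > 0"
    and "lam \<notin> complex_of_real ` {- 4 * max (1 / (b 1)\<^sup>2) (1 / (b 2)\<^sup>2) .. 0}"
  defines "r \<equiv> \<lambda>s. small_root (b s) lam"
    and "D \<equiv> complex_of_real (1 / (b 2)\<^sup>2) * (1 - r 2) + complex_of_real (1 / (b 1)\<^sup>2) * (1 - r 1)"
  shows "(\<forall>s\<in>{1, 2}. \<exists>!z. is_small_root (b s) lam z) \<and>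
    D \<noteq> 0 \<and> (\<forall>s\<in>{1, 2}. r s \<noteq> 0 \<and> r s - inverse (r s) \<noteq> 0) \<and>
    (\<forall>g\<in>l2 Zstar.
      (\<exists>!f. f \<in> l2 Zstar \<and> (\<lambda>j. opA b f j - lam * f j) = g) \<and>
      (\<forall>s\<in>{1, 2}. (\<lambda>k. r s ^ nat \<bar>k\<bar> * g k) summable_on Zhalf s) \<and>
      (\<forall>s\<in>{1, 2}. \<forall>j\<in>Zhalf s.
         (\<lambda>k. (r s ^ nat \<bar>j - k\<bar> - r s ^ (nat \<bar>j\<bar> + nat \<bar>k\<bar>)) * g k) summable_on Zhalf s) \<and>
      (\<forall>f. f \<in> l2 Zstar \<and> (\<lambda>j. opA b f j - lam * f j) = g \<longrightarrow>
        (\<forall>s\<in>{1, 2}. \<forall>j\<in>Zhalf s.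
          f j = - (r s ^ nat \<bar>j\<bar>) / D *
                  ((\<Sum>\<^sub>\<infinity>k\<in>Zhalf 1. r 1 ^ nat \<bar>k\<bar> * g k) + (\<Sum>\<^sub>\<infinity>k\<in>Zhalf 2. r 2 ^ nat \<bar>k\<bar> * g k))
                + complex_of_real ((b s)\<^sup>2) / (r s - inverse (r s)) *
                  (\<Sum>\<^sub>\<infinity>k\<in>Zhalf s.
                    (r s ^ nat \<bar>j - k\<bar> - r s ^ (nat \<bar>j\<bar> + nat \<bar>k\<bar>)) * g k))))"
proof -
  have pos: "b s > 0" if "s \<in> {1, 2}" for s using that assms(1,2) by auto
  have ex1: "\<exists>!z. is_small_root (b s) lam z" if s: "s \<in> {1, 2}" for s
  proof (rule ex1_small_root[OF pos[OF s]])
    have "1 / (b s)\<^sup>2 \<le> max (1 / (b 1)\<^sup>2) (1 / (b 2)\<^sup>2)" using s by auto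
    then have "{- 4 / (b s)\<^sup>2 .. 0} \<subseteq> {- 4 * max (1 / (b 1)\<^sup>2) (1 / (b 2)\<^sup>2) .. 0}"
      by auto
    then show "lam \<notin> complex_of_real ` {- 4 / (b s)\<^sup>2 .. 0}" using assms(3) by blast
  qed
  have root: "is_small_root (b s) lam (r s)" if "s \<in> {1, 2}" for s
    unfolding r_def by (rule is_small_root_small_root[OF ex1[OF that]])
  have r_nz: "r s \<noteq> 0" and r_lt: "cmod (r s) < 1" if "s \<in> {1, 2}" for s
    using root[OF that] is_small_root_nonzero is_small_root_def by blast+
  \<comment> \<open>\<open>D\<close> is a positive combination of numbers with positive real part.\<close>
  have re: "Re (1 - r s) > 0" if "s \<in> {1, 2}" for s
    using complex_Re_le_cmod[of "r s"] r_lt[OF that] by simp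
  have D_eq: "D = complex_of_real (1 / (b 2)\<^sup>2) * (1 - r 2) + complex_of_real (1 / (b 1)\<^sup>2) * (1 - r 1)"
    by (simp only: D_def)
  have "Re D = 1 / (b 2)\<^sup>2 * Re (1 - r 2) + 1 / (b 1)\<^sup>2 * Re (1 - r 1)"
    unfolding D_eq by (simp only: plus_complex.simps Re_complex_of_real times_complex.simps Im_complex_of_real)
  also have "\<dots> > 0"
    using re[of 1] re[of 2] assms(1,2) by (intro add_pos_pos mult_pos_pos) auto
  finally have D: "D \<noteq> 0" by auto
  have main: "(\<exists>!f. f \<in> l2 Zstar \<and> (\<lambda>j. opA b f j - lam * f j) = g)
    \<and> (\<forall>s\<in>{1, 2}. (\<lambda>k. r s ^ nat \<bar>k\<bar> * g k) summable_on Zhalf s)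
    \<and> (\<forall>s\<in>{1, 2}. \<forall>j\<in>Zhalf s.
         (\<lambda>k. (r s ^ nat \<bar>j - k\<bar> - r s ^ (nat \<bar>j\<bar> + nat \<bar>k\<bar>)) * g k) summable_on Zhalf s)
    \<and> (\<forall>f. f \<in> l2 Zstar \<and> (\<lambda>j. opA b f j - lam * f j) = g \<longrightarrow>
        (\<forall>s\<in>{1, 2}. \<forall>j\<in>Zhalf s.
          f j = - (r s ^ nat \<bar>j\<bar>) / D *
                  ((\<Sum>\<^sub>\<infinity>k\<in>Zhalf 1. r 1 ^ nat \<bar>k\<bar> * g k) + (\<Sum>\<^sub>\<infinity>k\<in>Zhalf 2. r 2 ^ nat \<bar>k\<bar> * g k))
                + complex_of_real ((b s)\<^sup>2) / (r s - inverse (r s)) *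
                  (\<Sum>\<^sub>\<infinity>k\<in>Zhalf s.
                    (r s ^ nat \<bar>j - k\<bar> - r s ^ (nat \<bar>j\<bar> + nat \<bar>k\<bar>)) * g k)))"
    if g: "g \<in> l2 Zstar" for g
  proof -
    define u where "u = - ((\<Sum>\<^sub>\<infinity>k\<in>Zhalf 1. r 1 ^ nat \<bar>k\<bar> * g k)
      + (\<Sum>\<^sub>\<infinity>k\<in>Zhalf 2. r 2 ^ nat \<bar>k\<bar> * g k)) / D"
    note sol_iff = resolvent_solution_iff[where r = r, OF assms(1,2) root D_eq D g u_def]
    have g_half: "(\<lambda>k. (cmod (g k))\<^sup>2) summable_on Zhalf s" if "s \<in> {1, 2}" for s
      using g that by (auto simp: l2_Zstar_iff)
    define f0 where "f0 j = (if j = 0 then 0 else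
      resolvent_formula b r g u (if j < 0 then 1 else 2) j)" for j
    have f0_unique: "f 0 = 0 \<and> (\<forall>s\<in>{1, 2}. \<forall>j\<in>Zhalf s. f j = resolvent_formula b r g u s j) \<longleftrightarrow> f = f0" for f
    proof
      assume f: "f 0 = 0 \<and> (\<forall>s\<in>{1, 2}. \<forall>j\<in>Zhalf s. f j = resolvent_formula b r g u s j)"
      show "f = f0"
      proof
        fix j :: int
        consider "j = 0" | "j \<in> Zhalf 1" "j < 0" | "j \<in> Zhalf 2" "j > 0"
          by (metis Zhalf_iff linorder_less_linear numeral_One numeral_eq_iff num.distinct(1))
        then show "f j = f0 j" using f by cases (auto simp: f0_def)
      qed
    next
      assume "f = f0"
      then show "f 0 = 0 \<and> (\<forall>s\<in>{1, 2}. \<forall>j\<in>Zhalf s. f j = resolvent_formula b r g u s j)"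
        by (simp add: f0_def Zhalf_iff)
    qed
    have "f \<in> l2 Zstar \<and> (\<lambda>j. opA b f j - lam * f j) = g \<longleftrightarrow> f = f0" for f
      using sol_iff[of f] f0_unique[of f] by (rule trans)
    then have "\<exists>!f. f \<in> l2 Zstar \<and> (\<lambda>j. opA b f j - lam * f j) = g" by simp
    moreover have "(\<lambda>k. r s ^ nat \<bar>k\<bar> * g k) summable_on Zhalf s" if "s \<in> {1, 2}" for s
      using r_lt g_half that by (intro summable_on_power_abs_times)
    moreover have "(\<lambda>k. (r s ^ nat \<bar>j - k\<bar> - r s ^ (nat \<bar>j\<bar> + nat \<bar>k\<bar>)) * g k) summable_on Zhalf s"
      if "s \<in> {1, 2}" for s j
      using summable_on_green_kernel_times[OF r_lt[OF that] g_half[OF that], of j]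
      by (simp only: green_kernel_def)
    moreover have "resolvent_formula b r g u s j = - (r s ^ nat \<bar>j\<bar>) / D *
                  ((\<Sum>\<^sub>\<infinity>k\<in>Zhalf 1. r 1 ^ nat \<bar>k\<bar> * g k) + (\<Sum>\<^sub>\<infinity>k\<in>Zhalf 2. r 2 ^ nat \<bar>k\<bar> * g k))
                + complex_of_real ((b s)\<^sup>2) / (r s - inverse (r s)) *
                  (\<Sum>\<^sub>\<infinity>k\<in>Zhalf s.
                    (r s ^ nat \<bar>j - k\<bar> - r s ^ (nat \<bar>j\<bar> + nat \<bar>k\<bar>)) * g k)" for s j
    proof -
      have "(\<Sum>\<^sub>\<infinity>k\<in>Zhalf s. green_kernel (r s) j k * (complex_of_real ((b s)\<^sup>2) * g k))
          = complex_of_real ((b s)\<^sup>2) * (\<Sum>\<^sub>\<infinity>k\<in>Zhalf s. green_kernel (r s) j k * g k)"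
        by (subst infsum_cmult_right'[symmetric]) (simp add: mult.left_commute)
      then show ?thesis
        unfolding resolvent_formula_def green_op_def u_def green_kernel_def[symmetric]
        by (simp only: times_divide_eq_left times_divide_eq_right mult_minus_left mult_minus_right
            mult.commute)
    qed
    ultimately show ?thesis using sol_iff by auto
  qed
  have "\<forall>s\<in>{1, 2}. \<exists>!z. is_small_root (b s) lam z" using ex1 by blast
  moreover have "\<forall>s\<in>{1, 2}. r s \<noteq> 0 \<and> r s - inverse (r s) \<noteq> 0"
    using r_nz r_lt minus_inverse_nonzero by blast
  ultimately show ?thesis using D main by (intro conjI ballI[OF main])
qed

end
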